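(* Let $p\ge 1$ be an integer. Every proportionally modular monoid of $\mathbb{N}^p$ is finitely generated. That is, for all nonzero linear functions $f(x_1,\dots,x_p)=f_1x_1+\dots+f_px_p$ and $g(x_1,\dots,x_p)=g_1x_1+\dots+g_px_p$ with $f_i,g_i\in\mathbb{Z}$ and every positive integer $b$, the submonoid $S=\{x\in\mathbb{N}^p \mid f(x) \bmod b\le g(x)\}$ of $\mathbb{N}^p$ has a finite generating set.
   Context: $\mathbb{N}$ is the set of non-negative integers. For an integer $a$ and a positive integer $b$, $a \bmod b$ denotes the remainder of the Euclidean division of $a$ by $b$, so $a\bmod b\in\{0,\dots,b-1\}$. A proportionally modular monoid of $\mathbb{N}^p$ is a set of the form $S=\{x\in\mathbb{N}^p\mid f(x)\bmod b\le g(x)\}$ with $f,g$ nonzero linear functions and $b$ a positive integer; by linearity of $f$ and $g$ it is a submonoid of $(\mathbb{N}^p,+)$. By clearing denominators, $f$ and $g$ are taken to have integer coefficients. A monoid is finitely generated if it equals the submonoid generated by some finite subset. *)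

theory Defs
  imports "HOL-Analysis.Finite_Cartesian_Product"
begin

definition add_submonoid :: "'a::comm_monoid_add set \<Rightarrow> bool" where
  "add_submonoid S \<longleftrightarrow> 0 \<in> S \<and> (\<forall>x\<in>S. \<forall>y\<in>S. x + y \<in> S)"

lemma add_submonoid_hull: "add_submonoid (add_submonoid hull A)"
  by (rule hull_in) (auto simp: add_submonoid_def)

definition finitely_generated_monoid :: "'a::comm_monoid_add set \<Rightarrow> bool" where
  "finitely_generated_monoid S \<longleftrightarrow> (\<exists>A. finite A \<and> A \<subseteq> S \<and> S = add_submonoid hull A)"

text \<open>A linear function is represented by its vector of coefficients, so that it is nonzero
  iff that vector is.\<close>

definition linear_form :: "int ^ 'p \<Rightarrow> nat ^ 'p \<Rightarrow> int" where
  "linear_form c x = (\<Sum>i\<in>UNIV. c $ i * int (x $ i))"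

definition proportionally_modular_monoid :: "int ^ 'p \<Rightarrow> int ^ 'p \<Rightarrow> int \<Rightarrow> (nat ^ 'p) set" where
  "proportionally_modular_monoid f g b = {x. linear_form f x mod b \<le> linear_form g x}"

lemma linear_form_0 [simp]: "linear_form c 0 = 0"
  by (simp add: linear_form_def)

lemma linear_form_add: "linear_form c (x + y) = linear_form c x + linear_form c y"
  by (simp add: linear_form_def distrib_left sum.distrib)

lemma linear_form_eq_0_iff: "(\<forall>x. linear_form c x = 0) \<longleftrightarrow> c = 0"
proof
  assume *: "\<forall>x. linear_form c x = 0"
  have "c $ i = 0" for i
  proof -
    have "linear_form c (axis i 1) = (\<Sum>j\<in>UNIV. if j = i then c $ j else 0)"
      unfolding linear_form_def by (rule sum.cong) (auto simp: axis_def)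
    with * show ?thesis by simp
  qed
  then show "c = 0" by (simp add: vec_eq_iff)
qed (simp add: linear_form_def)

lemma add_submonoid_proportionally_modular_monoid:
  assumes "b > 0"
  shows "add_submonoid (proportionally_modular_monoid f g b)"
proof -
  have "(u + v) mod b \<le> u mod b + v mod b" for u v :: int
    using zmod_le_nonneg_dividend[of "u mod b + v mod b" b] assms by (simp add: mod_add_eq)
  then show ?thesis
    unfolding add_submonoid_def proportionally_modular_monoid_def
    by (auto simp: linear_form_add intro: order_trans[OF _ add_mono])
qed

end

theory Submission
  imports Defs
begin

text \<open>The monoid \<open>S\<close> need not be closed under differences, but it is closed under enough of them. Let
  \<open>x\<close> and \<open>y\<close> be in \<open>S\<close>, with \<open>x\<close> below \<open>y\<close> coordinatewise. If \<open>f x\<close> and \<open>f y\<close> agree modulo \<open>b\<close>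
  and \<open>g x \<le> g y\<close>, then \<open>f (y - x) mod b = 0 \<le> g (y - x)\<close>, so \<open>y - x\<close> is in \<open>S\<close>.

  All these conditions together say that \<open>x\<close> is below \<open>y\<close> with respect to finitely many functions
  from \<open>S\<close> to the natural numbers: the coordinates, the form \<open>g\<close> (which is nonnegative on \<open>S\<close>),
  and the pair \<open>f x mod b\<close>, \<open>b - f x mod b\<close>, whose simultaneous growth forces the residues to be
  equal. By Dickson's lemma (\<open>dickson_finite_family\<close>), every infinite subset of \<open>S\<close> contains two
  distinct elements that are comparable in this sense. Two distinct atoms, that is, nonzero elements
  of \<open>S\<close> that are not sums of two nonzero elements of \<open>S\<close>, are never comparable, because the larger
  would then be the smaller plus a nonzero element of \<open>S\<close>. Hence there are only finitely many atoms,
  and they generate \<open>S\<close> by induction on the coordinate sum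
  (\<open>finitely_generated_monoid_if_subtractive\<close>).\<close>

lemma nat_seq_nondecreasing_subseq:
  fixes s :: "nat \<Rightarrow> nat"
  obtains r :: "nat \<Rightarrow> nat" where "strict_mono r" "incseq (\<lambda>n. s (r n))"
proof -
  obtain r :: "nat \<Rightarrow> nat" where r: "strict_mono r" "monoseq (\<lambda>n. s (r n))"
    using seq_monosub[of s] by blast
  show thesis
  proof (cases "incseq (\<lambda>n. s (r n))")
    case True
    with r that show thesis by blast
  next
    case False
    with r(2) have dec: "decseq (\<lambda>n. s (r n))"
      by (simp add: monoseq_iff)
    \<comment> \<open>A decreasing sequence of natural numbers is constant from where it attains its minimum.\<close>
    obtain n0 where n0: "\<And>n. s (r n0) \<le> s (r n)"
      using ex_has_least_nat[of "\<lambda>_. True" _ "\<lambda>n. s (r n)"] by auto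
    have "s (r (n0 + n)) = s (r n0)" for n
      using n0[of "n0 + n"] decseqD[OF dec, of n0 "n0 + n"] by simp
    then have "incseq (\<lambda>n. s (r (n0 + n)))"
      by (simp add: incseq_def)
    moreover have "strict_mono (\<lambda>n. r (n0 + n))"
      using r(1) by (simp add: strict_mono_def)
    ultimately show thesis using that by blast
  qed
qed

lemma common_nondecreasing_subseq:
  fixes H :: "('a \<Rightarrow> nat) set" and s :: "nat \<Rightarrow> 'a"
  assumes "finite H"
  shows "\<exists>r :: nat \<Rightarrow> nat. strict_mono r \<and> (\<forall>h\<in>H. incseq (\<lambda>n. h (s (r n))))"
  using assms
proof induction
  case empty
  show ?case using strict_mono_id by auto
next
  case (insert h H)
  then obtain r :: "nat \<Rightarrow> nat"
    where r: "strict_mono r" "\<forall>k\<in>H. incseq (\<lambda>n. k (s (r n)))" by blast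
  obtain q where q: "strict_mono q" "incseq (\<lambda>n. h (s (r (q n))))"
    using nat_seq_nondecreasing_subseq[of "\<lambda>n. h (s (r n))"] by blast
  have "strict_mono (\<lambda>n. r (q n))"
    using r(1) q(1) by (simp add: strict_mono_def)
  moreover have "incseq (\<lambda>n. k (s (r (q n))))" if "k \<in> H" for k
    using r(2) that strict_mono_mono[OF q(1)] by (auto simp: incseq_def mono_def)
  ultimately show ?case using q(2) by (intro exI[of _ "\<lambda>n. r (q n)"]) auto
qed

text \<open>This form of Dickson's lemma compares elements through an arbitrary finite family of
  functions instead of coordinates, so that linear forms and residues can be compared along with
  the coordinates.\<close>

lemma dickson_finite_family:
  fixes H :: "('a \<Rightarrow> nat) set"
  assumes "finite H" and "infinite A"
  obtains x y where "x \<in> A" "y \<in> A" "x \<noteq> y" "\<And>h. h \<in> H \<Longrightarrow> h x \<le> h y"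
proof -
  obtain s :: "nat \<Rightarrow> 'a" where s: "inj s" "range s \<subseteq> A"
    using infinite_countable_subset[OF assms(2)] by blast
  obtain r :: "nat \<Rightarrow> nat"
    where r: "strict_mono r" "\<forall>h\<in>H. incseq (\<lambda>n. h (s (r n)))"
    using common_nondecreasing_subseq[OF assms(1), of s] by blast
  show thesis
  proof (rule that)
    show "s (r 0) \<in> A" "s (r 1) \<in> A" using s(2) by auto
    have "r 0 \<noteq> r 1" using r(1) by (auto dest: strict_monoD[of _ 0 1])
    then show "s (r 0) \<noteq> s (r 1)" using s(1) by (auto dest: injD)
    show "h (s (r 0)) \<le> h (s (r 1))" if "h \<in> H" for h
      using r(2) that by (auto simp: incseq_def)
  qed
qed

definition atoms :: "'a::comm_monoid_add set \<Rightarrow> 'a set" where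
  "atoms S = {x \<in> S. x \<noteq> 0 \<and> (\<forall>u\<in>S. \<forall>v\<in>S. x = u + v \<longrightarrow> u = 0 \<or> v = 0)}"

text \<open>The degree \<open>w\<close> strictly decreases from a sum to each of two nonzero summands, so splitting
  an element into nonzero summands stops, and it stops at atoms.\<close>

lemma hull_atoms_eq:
  fixes S :: "'a::comm_monoid_add set" and w :: "'a \<Rightarrow> nat"
  assumes S: "add_submonoid S"
    and w_add: "\<And>x y. w (x + y) = w x + w y"
    and w_zero: "\<And>x. w x = 0 \<Longrightarrow> x = 0"
  shows "add_submonoid hull (atoms S) = S"
proof
  show "add_submonoid hull (atoms S) \<subseteq> S"
    by (rule hull_minimal) (auto simp: atoms_def S)
  have hull: "0 \<in> add_submonoid hull (atoms S)"
    "\<And>u v. u \<in> add_submonoid hull (atoms S) \<Longrightarrow> v \<in> add_submonoid hull (atoms S)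
      \<Longrightarrow> u + v \<in> add_submonoid hull (atoms S)"
    using add_submonoid_hull[of "atoms S"] by (auto simp: add_submonoid_def)
  have "x \<in> add_submonoid hull (atoms S)" if "x \<in> S" for x
    using that
  proof (induction "w x" arbitrary: x rule: less_induct)
    case less
    consider "x = 0" | "x \<in> atoms S"
      | u v where "u \<in> S" "v \<in> S" "x = u + v" "u \<noteq> 0" "v \<noteq> 0"
      using less.prems by (auto simp: atoms_def)
    then show ?case
    proof cases
      case 1
      then show ?thesis using hull(1) by simp
    next
      case 2
      then show ?thesis by (rule hull_inc)
    next
      case (3 u v)
      then have "w u < w x" "w v < w x"
        using w_zero[of u] w_zero[of v] by (auto simp: w_add)
      with 3 less.hyps hull(2) show ?thesis by blast
    qed
  qed
  then show "S \<subseteq> add_submonoid hull (atoms S)" by blast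
qed

text \<open>The hypothesis \<open>sub\<close> makes the atoms an antichain for the quasi-order defined by \<open>H\<close>, and
  antichains for it are finite by Dickson's lemma.\<close>

lemma finitely_generated_monoid_if_subtractive:
  fixes S :: "'a::comm_monoid_add set" and w :: "'a \<Rightarrow> nat" and H :: "('a \<Rightarrow> nat) set"
  assumes S: "add_submonoid S"
    and w_add: "\<And>x y. w (x + y) = w x + w y"
    and w_zero: "\<And>x. w x = 0 \<Longrightarrow> x = 0"
    and H: "finite H"
    and sub: "\<And>x y. x \<in> S \<Longrightarrow> y \<in> S \<Longrightarrow> (\<And>h. h \<in> H \<Longrightarrow> h x \<le> h y) \<Longrightarrow> \<exists>z\<in>S. y = x + z"
  shows "finitely_generated_monoid S"
proof -
  have "finite (atoms S)"
  proof (rule ccontr)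
    assume "infinite (atoms S)"
    then obtain x y where xy: "x \<in> atoms S" "y \<in> atoms S" "x \<noteq> y" "\<And>h. h \<in> H \<Longrightarrow> h x \<le> h y"
      using dickson_finite_family[OF H] by blast
    then obtain z where "z \<in> S" "y = x + z"
      using sub[of x y] by (auto simp: atoms_def)
    moreover from this xy(3) have "z \<noteq> 0" by auto
    ultimately show False using xy(1,2) unfolding atoms_def by blast
  qed
  moreover have "atoms S \<subseteq> S" by (auto simp: atoms_def)
  moreover have "S = add_submonoid hull (atoms S)"
    using hull_atoms_eq[of S w] S w_add w_zero by simp
  ultimately show ?thesis unfolding finitely_generated_monoid_def by blast
qed

theorem theorem3:
  fixes f g :: "int ^ 'p" and b :: int
  assumes "f \<noteq> 0" and "g \<noteq> 0" and "b > 0"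
  shows "finitely_generated_monoid (proportionally_modular_monoid f g b)"
proof -
  let ?S = "proportionally_modular_monoid f g b"
  let ?f = "linear_form f" and ?g = "linear_form g"
  define H :: "(nat ^ 'p \<Rightarrow> nat) set" where
    "H = range (\<lambda>i x. x $ i)
      \<union> {\<lambda>x. nat (?g x), \<lambda>x. nat (?f x mod b), \<lambda>x. nat (b - ?f x mod b)}"
  show ?thesis
  proof (rule finitely_generated_monoid_if_subtractive[where w = "\<lambda>x. \<Sum>i\<in>UNIV. x $ i" and H = H])
    show "add_submonoid ?S"
      using assms(3) by (rule add_submonoid_proportionally_modular_monoid)
    show "finite H" by (simp add: H_def)
    show "(\<Sum>i\<in>UNIV. (x + y) $ i) = (\<Sum>i\<in>UNIV. x $ i) + (\<Sum>i\<in>UNIV. y $ i)" for x y :: "nat ^ 'p"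
      by (simp add: sum.distrib)
    show "x = 0" if "(\<Sum>i\<in>UNIV. x $ i) = 0" for x :: "nat ^ 'p"
      using that by (simp add: vec_eq_iff)
    fix x y :: "nat ^ 'p"
    assume x: "x \<in> ?S" and y: "y \<in> ?S" and le: "\<And>h. h \<in> H \<Longrightarrow> h x \<le> h y"
    have mod_bounds: "0 \<le> ?f z mod b" "?f z mod b < b" for z
      using assms(3) by simp_all
    have "x $ i \<le> y $ i" for i
      by (rule le) (auto simp: H_def)
    then have y_eq: "y = x + (y - x)"
      by (simp add: vec_eq_iff)
    have "nat (?g x) \<le> nat (?g y)"
      by (rule le) (simp add: H_def)
    moreover have "0 \<le> ?g y"
      using y mod_bounds(1)[of y] by (simp add: proportionally_modular_monoid_def)
    ultimately have "?g x \<le> ?g y" by simp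
    then have "0 \<le> ?g (y - x)"
      using linear_form_add[of g x "y - x"] y_eq by simp
    have "nat (?f x mod b) \<le> nat (?f y mod b)" "nat (b - ?f x mod b) \<le> nat (b - ?f y mod b)"
      by (rule le, simp add: H_def)+
    then have "?f x mod b = ?f y mod b"
      using mod_bounds[of x] mod_bounds[of y] by linarith
    then have "b dvd ?f y - ?f x"
      by (simp add: mod_eq_dvd_iff[symmetric])
    then have "?f (y - x) mod b = 0"
      using linear_form_add[of f x "y - x"] y_eq by simp
    with \<open>0 \<le> ?g (y - x)\<close> have "y - x \<in> ?S"
      by (simp add: proportionally_modular_monoid_def)
    with y_eq show "\<exists>z\<in>?S. y = x + z" by blast
  qed
qed

end
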